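(* Let $A$ be a finite alphabet, $F$ a cellular automaton on $A^{\mathbb{Z}^2}$, and $\mu$ a bi-invariant probability measure (invariant under $F$ and under all shifts). For any finite measurable partition $\mathcal{P}$ of $A^{\mathbb{Z}^2}$ one has $$ER_\mu(\mathcal{P},F)\le ER_\mu(\mathcal{S}_0,F),$$ and therefore $$ER_\mu(A^{\mathbb{Z}^2},F)=ER_\mu(\mathcal{S}_0,F).$$
   Context: $A^{\mathbb{Z}^2}$ carries the product of discrete topologies and its Borel $\sigma$-algebra. The shifts are $\sigma^v(x)_u=x_{u+v}$, $u,v\in\mathbb{Z}^2$. Let $E_n=\{(i,j)\in\mathbb{Z}^2: -n\le i,j\le n\}$. A cellular automaton (CA) $F$ is a continuous self-map of $A^{\mathbb{Z}^2}$ commuting with all shifts; equivalently there are $r\in\mathbb{N}$ and $f:A^{E_r}\to A$ with $F(x)_z=f\big((x_{z+u})_{u\in E_r}\big)$ for all $z$; such an $r$ is called the radius of $F$. For $n\ge r$, $E'_n=E_n\setminus E_{n-r}$. For a finite measurable partition $\mathcal{P}$ of $A^{\mathbb{Z}^2}$, $\mathcal{P}'_n=\bigvee_{v\in E'_n}\sigma^v(\mathcal{P})$. $\mathcal{S}_0$ is the partition according to the value of the coordinate at $(0,0)$. $h_\mu(\mathcal{P},F)=\lim_{N}\frac1N H_\mu(\bigvee_{i=0}^{N-1}F^{-i}\mathcal{P})$ with $H_\mu$ the Shannon entropy of a partition. For an $F$-invariant probability measure $\mu$, $ER_\mu(\mathcal{P},F)=\limsup_{n\to\infty}\frac1n h_\mu(\mathcal{P}'_n,F)$,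 and $ER_\mu(A^{\mathbb{Z}^2},F)=\sup_{\mathcal{P}}ER_\mu(\mathcal{P},F)$ over all finite measurable partitions. *)

theory Defs
  imports "HOL-Probability.Probability"
begin

type_synonym 'a config = "int \<times> int \<Rightarrow> 'a"

definition config_topology :: "'a config topology" where
  "config_topology = product_topology (\<lambda>_. discrete_topology UNIV) UNIV"

definition config_borel :: "'a config measure" where
  "config_borel = sigma UNIV {U. openin config_topology U}"

definition shift :: "int \<times> int \<Rightarrow> 'a config \<Rightarrow> 'a config" where
  "shift v x = (\<lambda>u. x (u + v))"

definition square :: "nat \<Rightarrow> (int \<times> int) set" where
  "square n = {- int n..int n} \<times> {- int n..int n}"

definition cellular_automaton :: "('a config \<Rightarrow> 'a config) \<Rightarrow> bool" where
  "cellular_automaton F \<longleftrightarrow>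
     continuous_map config_topology config_topology F \<and> (\<forall>v. F \<circ> shift v = shift v \<circ> F)"

text \<open>
  The local rule is applied to elements of \<open>square r \<rightarrow>\<^sub>E UNIV\<close>. Any \<open>r\<close> admitting a local
  rule counts as a radius; it need not be the smallest one.
\<close>

definition has_radius :: "('a config \<Rightarrow> 'a config) \<Rightarrow> nat \<Rightarrow> bool" where
  "has_radius F r \<longleftrightarrow>
     (\<exists>f. \<forall>x z. F x z = f (restrict (\<lambda>u. x (z + u)) (square r)))"

definition invariant_under :: "'a measure \<Rightarrow> ('a \<Rightarrow> 'a) \<Rightarrow> bool" where
  "invariant_under \<mu> T \<longleftrightarrow> T \<in> measurable \<mu> \<mu> \<and> distr \<mu> \<mu> T = \<mu>"

definition bi_invariant_prob :: "'a config measure \<Rightarrow> ('a config \<Rightarrow> 'a config) \<Rightarrow> bool" where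
  "bi_invariant_prob \<mu> F \<longleftrightarrow>
     prob_space \<mu> \<and> sets \<mu> = sets config_borel \<and>
     invariant_under \<mu> F \<and> (\<forall>v. invariant_under \<mu> (shift v))"

definition finite_measurable_partition :: "'a measure \<Rightarrow> 'a set set \<Rightarrow> bool" where
  "finite_measurable_partition \<mu> P \<longleftrightarrow>
     finite P \<and> partition_on (space \<mu>) P \<and> P \<subseteq> sets \<mu>"

text \<open>
  The join of a family of partitions of \<open>UNIV\<close> is \<^const>\<open>common_refinement\<close>; it discards empty
  cells, and the join of the empty family is \<open>{UNIV}\<close>.
\<close>

definition pullback_partition :: "('a \<Rightarrow> 'a) \<Rightarrow> 'a set set \<Rightarrow> 'a set set" where
  "pullback_partition T P = (\<lambda>B. T -` B) ` P - {{}}"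

definition partition_entropy :: "'a measure \<Rightarrow> 'a set set \<Rightarrow> real" where
  "partition_entropy \<mu> P = - (\<Sum>B\<in>P. measure \<mu> B * ln (measure \<mu> B))"

definition dynamical_entropy :: "'a measure \<Rightarrow> 'a set set \<Rightarrow> ('a \<Rightarrow> 'a) \<Rightarrow> real" where
  "dynamical_entropy \<mu> P F =
     lim (\<lambda>N. partition_entropy \<mu> (common_refinement ((\<lambda>i. pullback_partition (F ^^ i) P) ` {..<N}))
               / real N)"

text \<open>
  Only meaningful for \<open>n \<ge> r\<close>; for smaller \<open>n\<close> the subtraction is truncated, which does not
  affect the limit superior below.
\<close>

definition frame :: "nat \<Rightarrow> nat \<Rightarrow> (int \<times> int) set" where
  "frame r n = square n - square (n - r)"

definition frame_partition :: "nat \<Rightarrow> nat \<Rightarrow> 'a config set set \<Rightarrow> 'a config set set" where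
  "frame_partition r n P = common_refinement ((\<lambda>v. (\<lambda>B. shift v ` B) ` P) ` frame r n)"

definition entropy_rate ::
  "'a config measure \<Rightarrow> ('a config \<Rightarrow> 'a config) \<Rightarrow> nat \<Rightarrow> 'a config set set \<Rightarrow> ereal" where
  "entropy_rate \<mu> F r P =
     limsup (\<lambda>n. ereal (dynamical_entropy \<mu> (frame_partition r n P) F / real n))"

definition total_entropy_rate ::
  "'a config measure \<Rightarrow> ('a config \<Rightarrow> 'a config) \<Rightarrow> nat \<Rightarrow> ereal" where
  "total_entropy_rate \<mu> F r = (SUP P \<in> {P. finite_measurable_partition \<mu> P}. entropy_rate \<mu> F r P)"

definition origin_partition :: "'a config set set" where
  "origin_partition = range (\<lambda>a. {x. x (0, 0) = a})"

end

theory Submission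
  imports Defs
begin

text \<open>
  Write \<open>S\<^sub>D\<close> for the partition according to the pattern on \<open>D\<close> and fix \<open>P\<close>. Some \<open>S\<^sub>D\<close> with
  \<open>D = E\<^sub>m\<close> makes the conditional entropy \<open>H(P | S\<^sub>D)\<close> small, because measurable sets are
  approximated by cylinders. Replacing \<open>P\<close> by \<open>S\<^sub>D\<close> in each of the \<open>O(n)\<close> translates over the frame
  \<open>E'\<^sub>n\<close> therefore changes the entropy by at most \<open>O(n) H(P | S\<^sub>D)\<close>, and the result is coarser
  than the full pattern on \<open>E\<^sub>n\<^sub>+\<^sub>m\<close>. Since frames are as wide as the radius, the history of the
  frame \<open>E'\<^sub>n\<^sub>+\<^sub>m\<close> and the initial pattern on \<open>E\<^sub>n\<^sub>+\<^sub>m\<close> determine the history of \<open>E\<^sub>n\<^sub>+\<^sub>m\<close>, so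
  the square and the frame have the same entropy per unit of time. Dividing by \<open>n\<close> and letting
  first \<open>n\<close> and then \<open>m\<close> tend to infinity gives the inequality.
\<close>

section \<open>Partitions as fibers\<close>

text \<open>Partitions are handled as the fibers of functions, so that joins become tuples of functions
  and a partition is coarser than another when its function factors through the other one.\<close>

definition fibers :: "('s \<Rightarrow> 'v) \<Rightarrow> 's set set" where
  "fibers X = range (\<lambda>x. {y. X y = X x})"

definition joint :: "'i set \<Rightarrow> ('i \<Rightarrow> 's \<Rightarrow> 'v) \<Rightarrow> 's \<Rightarrow> 'i \<Rightarrow> 'v" where
  "joint I X x = (\<lambda>i\<in>I. X i x)"

lemma joint_eq_iff: "joint I X x = joint I X y \<longleftrightarrow> (\<forall>i\<in>I. X i x = X i y)"
  by (auto simp: joint_def restrict_def fun_eq_iff)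

lemma fibers_cong:
  assumes "\<And>x y. X x = X y \<longleftrightarrow> Y x = Y y"
  shows "fibers X = fibers Y"
  unfolding fibers_def using assms by auto

lemma fibers_iff: "B \<in> fibers X \<longleftrightarrow> (\<exists>x. B = {y. X y = X x})"
  unfolding fibers_def by auto

text \<open>A nonempty intersection of chosen cells contains a point \<open>x\<close>, and each
  chosen cell must then be the fiber through \<open>x\<close>. Conversely, the cells through any
  point form such a choice.\<close>

lemma common_refinement_fibers:
  fixes X :: "'i \<Rightarrow> 's \<Rightarrow> 'v"
  shows "common_refinement ((\<lambda>i. fibers (X i)) ` I) = fibers (joint I X)"
proof (rule set_eqI, rule iffI)
  fix C assume "C \<in> common_refinement ((\<lambda>i. fibers (X i)) ` I)"
  then obtain f where f: "\<And>i. i \<in> I \<Longrightarrow> f (fibers (X i)) \<in> fibers (X i)"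
    and C: "C = (\<Inter>i\<in>I. f (fibers (X i)))" "C \<noteq> {}"
    unfolding common_refinement by (auto simp: image_image)
  from C obtain x where x: "\<And>i. i \<in> I \<Longrightarrow> x \<in> f (fibers (X i))" by auto
  have "f (fibers (X i)) = {y. X i y = X i x}" if i: "i \<in> I" for i
  proof -
    from f[OF i] obtain z where "f (fibers (X i)) = {y. X i y = X i z}"
      unfolding fibers_iff by blast
    with x[OF i] show ?thesis by simp
  qed
  then have "C = {y. joint I X y = joint I X x}"
    unfolding C(1) joint_eq_iff by (simp cong: INF_cong) blast
  then show "C \<in> fibers (joint I X)" unfolding fibers_iff ..
next
  fix C assume "C \<in> fibers (joint I X)"
  then obtain x where C: "C = {y. \<forall>i\<in>I. X i y = X i x}"
    by (auto simp: fibers_def joint_eq_iff)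
  \<comment> \<open>\<open>common_refinement\<close> chooses from partitions rather than from
    indices, so the cell through \<open>x\<close> is selected from the partition alone. Indices with
    equal fibers then cause no conflict.\<close>
  define f where "f P = (SOME B. B \<in> P \<and> x \<in> B)" for P :: "'s set set"
  have f: "f (fibers (X i)) = {y. X i y = X i x}" for i
    unfolding f_def by (rule some_equality) (auto simp: fibers_def)
  have "f \<in> (\<Pi> P\<in>(\<lambda>i. fibers (X i)) ` I. P)"
    using f by (auto simp: fibers_iff)
  moreover have "C = \<Inter> (f ` (\<lambda>i. fibers (X i)) ` I)"
    unfolding C image_image f by auto
  moreover have "C \<noteq> {}" using C by auto
  ultimately show "C \<in> common_refinement ((\<lambda>i. fibers (X i)) ` I)"
    unfolding common_refinement by blast
qed

lemma pullback_partition_fibers: "pullback_partition T (fibers X) = fibers (\<lambda>x. X (T x))"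
proof (rule set_eqI, rule iffI)
  fix C assume "C \<in> pullback_partition T (fibers X)"
  then obtain z where C: "C = T -` {y. X y = X z}" "C \<noteq> {}"
    by (auto simp: pullback_partition_def fibers_def)
  then obtain x where "X (T x) = X z" by auto
  with C have "C = {y. X (T y) = X (T x)}" by auto
  then show "C \<in> fibers (\<lambda>x. X (T x))" by (auto simp: fibers_def)
next
  fix C assume "C \<in> fibers (\<lambda>x. X (T x))"
  then obtain x where "C = T -` {y. X y = X (T x)}" "x \<in> C" by (auto simp: fibers_def)
  then show "C \<in> pullback_partition T (fibers X)"
    unfolding pullback_partition_def fibers_def by blast
qed

lemma shift_shift [simp]: "shift u (shift v x) = shift (u + v) x"
  by (simp add: shift_def fun_eq_iff add.assoc)

lemma shift_zero [simp]: "shift 0 x = x"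
  by (simp add: shift_def)

text \<open>The image under a shift is the preimage under the inverse shift, which is where the
  minus sign comes from.\<close>

lemma shift_image_fibers:
  fixes X :: "'a config \<Rightarrow> 'v"
  shows
  "(\<lambda>B. shift v ` B) ` fibers X = fibers (\<lambda>x. X (shift (- v) x))"
proof -
  have 1: "shift v ` {y. X y = c} = {y. X (shift (- v) y) = c}" for c
  proof (intro set_eqI iffI)
    fix y assume "y \<in> {y. X (shift (- v) y) = c}"
    then show "y \<in> shift v ` {y. X y = c}"
      by (intro image_eqI[of _ _ "shift (- v) y"]) simp_all
  qed auto
  have "surj (shift (- v) :: 'a config \<Rightarrow> 'a config)"
    by (rule surjI[of _ "shift v"]) simp
  then have 2: "range (\<lambda>x. g (shift (- v) x)) = range g" for g :: "'a config \<Rightarrow> 'a config set"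
    by (metis image_image)
  show ?thesis
    unfolding fibers_def image_image 1
    by (rule 2[of "\<lambda>z. {y. X (shift (- v) y) = X z}", symmetric])
qed

text \<open>The function sends each point to the cell containing it, so the values are the cells
  themselves and \<open>X x = B\<close> becomes membership.\<close>

lemma partition_on_UNIV_fibers:
  assumes "partition_on UNIV P"
  obtains X where "P = fibers X" "range X = P" "\<And>x B. B \<in> P \<Longrightarrow> X x = B \<longleftrightarrow> x \<in> B"
proof -
  have "\<exists>B. B \<in> P \<and> x \<in> B" for x
    using partition_onD1[OF assms] by blast
  then have "\<forall>x. \<exists>B. B \<in> P \<and> x \<in> B" by simp
  from choice[OF this] obtain X where "\<forall>x. X x \<in> P \<and> x \<in> X x" by (rule exE)
  then have X: "X x \<in> P" "x \<in> X x" for x by simp_all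
  have iff: "X x = B \<longleftrightarrow> x \<in> B" if "B \<in> P" for x B
  proof
    assume "x \<in> B"
    then have "X x \<inter> B \<noteq> {}" using IntI[OF X(2)[of x]] by (metis emptyE)
    then show "X x = B"
      using disjointD[OF partition_onD2[OF assms] X(1) that] by (rule contrapos_np)
  qed (use X(2)[of x] in simp)
  have ran: "range X = P"
  proof (intro equalityI subsetI)
    fix B assume B: "B \<in> P"
    then have "B \<noteq> {}" using partition_onD3[OF assms] by metis
    then obtain x where "x \<in> B" by auto
    then have "X x = B" using iff[OF B] by simp
    then show "B \<in> range X" by (rule range_eqI[OF sym])
  qed (use X(1) in auto)
  have "{y. X y = X x} = X x" for x
    by (simp add: iff[OF X(1)])
  then have "P = fibers X"
    by (simp add: fibers_def ran)
  then show ?thesis by (rule that[OF _ ran iff])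
qed

text \<open>Constant configurations realise every letter, so every cell of
  \<open>origin_partition\<close> is a fiber.\<close>

lemma origin_partition_fibers: "(origin_partition :: 'a config set set) = fibers (\<lambda>x. x (0, 0))"
proof -
  have "surj (\<lambda>x :: 'a config. x (0, 0))"
    by (rule surjI[of _ "\<lambda>a _. a"]) simp
  then have "range (\<lambda>x :: 'a config. g (x (0, 0))) = range g" for g :: "'a \<Rightarrow> 'a config set"
    by (metis image_image)
  from this[of "\<lambda>a. {x. x (0, 0) = a}"] show ?thesis
    unfolding origin_partition_def fibers_def by simp
qed

lemma frame_partition_fibers:
  "frame_partition r n (fibers X) = fibers (joint (frame r n) (\<lambda>v x. X (shift (- v) x)))"
  unfolding frame_partition_def by (simp add: shift_image_fibers common_refinement_fibers)

text \<open>Fekete's argument: divide \<open>n\<close> by a fixed \<open>k\<close> whose quotient is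
  close to the infimum. Subadditivity bounds \<open>a n\<close> by \<open>n div k\<close> copies of
  \<open>a k\<close> and one remainder term.\<close>

lemma fekete_convergent:
  fixes a :: "nat \<Rightarrow> real"
  assumes sub: "\<And>m n. a (m + n) \<le> a m + a n" and nonneg: "\<And>n. 0 \<le> a n"
  shows "convergent (\<lambda>n. a n / real n)"
proof -
  \<comment> \<open>The index 0 is left out because division by zero would contribute the value 0 to
    the infimum.\<close>
  define L where "L = (INF n\<in>{1..}. a n / real n)"
  have bdd: "bdd_below ((\<lambda>n. a n / real n) ` {1..})"
    by (rule bdd_belowI[of _ 0]) (auto simp: nonneg)
  have L_le: "L \<le> a n / real n" if "n \<ge> 1" for n
    unfolding L_def using bdd that by (intro cINF_lower) auto
  have mult: "a (q * k + s) \<le> real q * a k + a s" for q k s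
  proof (induction q)
    case (Suc q)
    have "a (Suc q * k + s) \<le> a k + a (q * k + s)"
      using sub[of k "q * k + s"] by (simp add: add.assoc)
    with Suc show ?case by (simp add: algebra_simps)
  qed simp
  have "(\<lambda>n. a n / real n) \<longlonglongrightarrow> L"
  proof (rule LIMSEQ_I)
    fix e :: real assume e: "0 < e"
    have "\<exists>k\<in>{1..}. a k / real k < L + e / 2"
      using e cINF_less_iff[OF _ bdd, of "L + e / 2"] by (auto simp: L_def)
    then obtain k where k: "k \<ge> 1" "a k / real k < L + e / 2" by auto
    \<comment> \<open>There are only \<open>k\<close> possible remainders, so one constant bounds
      all remainder terms and vanishes after division by \<open>n\<close>.\<close>
    define K where "K = Max (a ` {..<k})"
    have K: "a s \<le> K" if "s < k" for s unfolding K_def using that by (intro Max_ge) auto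
    have K0: "K \<ge> 0" using K[of 0] k nonneg[of 0] by auto
    obtain n0 :: nat where n0: "real n0 > 2 * K / e" using reals_Archimedean2 by blast
    show "\<exists>no. \<forall>n\<ge>no. norm (a n / real n - L) < e"
    proof (intro exI allI impI)
      fix n assume n: "n \<ge> max 1 n0"
      have n1: "real n > 0" using n by auto
      have "a n \<le> real (n div k) * a k + a (n mod k)"
        using mult[of "n div k" k "n mod k"] by simp
      also have "\<dots> \<le> real n / real k * a k + K"
      proof (intro add_mono mult_right_mono K)
        show "real (n div k) \<le> real n / real k" 
        proof -
          have "real (n div k * k) \<le> real n" by (intro of_nat_mono div_times_less_eq_dividend)
          then show ?thesis using k(1) by (simp add: pos_le_divide_eq)
        qed
        show "n mod k < k" using k by auto
      qed (rule nonneg)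
      finally have "a n / real n \<le> (real n / real k * a k + K) / real n"
        using n1 by (intro divide_right_mono) auto
      also have "\<dots> = a k / real k + K / real n" using n1 by (simp add: field_simps)
      also have "K / real n < e / 2"
      proof -
        have "2 * K / e < real n" using n n0 by linarith
        then show ?thesis using e n1 by (simp add: field_simps)
      qed
      finally have "a n / real n < L + e" using k by linarith
      moreover have "L \<le> a n / real n" using L_le n by auto
      ultimately show "norm (a n / real n - L) < e" by auto
    qed
  qed
  then show ?thesis by (rule convergentI)
qed

section \<open>Entropy of simple functions\<close>

lemma factor_through:
  assumes "\<And>x y. X x = X y \<Longrightarrow> Y x = Y y"
  obtains g where "Y = g \<circ> X"
proof
  show "Y = (\<lambda>v. Y (SOME x. X x = v)) \<circ> X"
  proof
    fix x
    have "X (SOME y. X y = X x) = X x" by (rule someI[of _ x]) simp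
    then show "Y x = ((\<lambda>v. Y (SOME x. X x = v)) \<circ> X) x"
      using assms[of "SOME y. X y = X x" x] by simp
  qed
qed

locale prob_space_UNIV = prob_space M for M :: "'s measure" +
  assumes space_UNIV [simp]: "space M = UNIV"
begin

abbreviation ent :: "('s \<Rightarrow> 'v) \<Rightarrow> real" where
  "ent X \<equiv> partition_entropy M (fibers X)"

lemma vimage_in_sets_simple: "simple_function M X \<Longrightarrow> X -` A \<in> sets M"
  using simple_functionD(2)[of M X A] by simp

lemma simple_function_comp_measurable:
  assumes "simple_function M X" "T \<in> measurable M M"
  shows "simple_function M (\<lambda>x. X (T x))"
  unfolding simple_function_eq_measurable
proof
  show "finite ((\<lambda>x. X (T x)) ` space M)"
    by (rule finite_subset[OF _ simple_functionD(1)[OF assms(1)]]) auto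
  show "(\<lambda>x. X (T x)) \<in> measurable M (count_space UNIV)"
    using measurable_compose[OF assms(2) measurable_simple_function[OF assms(1)]] .
qed

lemma simple_function_joint:
  assumes "finite I" "\<And>i. i \<in> I \<Longrightarrow> simple_function M (X i)"
  shows "simple_function M (joint I X)"
  unfolding simple_function_def
proof safe
  have "joint I X ` space M \<subseteq> (\<Pi>\<^sub>E i\<in>I. X i ` UNIV)"
    by (auto simp: joint_def)
  moreover have "finite (\<Pi>\<^sub>E i\<in>I. X i ` UNIV)"
    using assms simple_functionD(1)[of M] by (intro finite_PiE) auto
  ultimately show "finite (joint I X ` space M)" by (rule finite_subset)
  fix x
  have "joint I X -` {joint I X x} \<inter> space M = {y\<in>space M. \<forall>i\<in>I. X i y \<in> {X i x}}"
    by (auto simp: joint_eq_iff)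
  also have "\<dots> \<in> sets M"
  proof (rule sets.sets_Collect_finite_All)
    fix i assume "i \<in> I"
    from vimage_in_sets_simple[OF assms(2)[OF this], of "{X i x}"]
    show "{y \<in> space M. X i y \<in> {X i x}} \<in> sets M" by (simp add: vimage_def)
  qed (rule assms)
  finally show "joint I X -` {joint I X x} \<inter> space M \<in> sets M" .
qed

lemma ent_eq_sum:
  assumes "simple_function M X"
  shows "ent X = - (\<Sum>v\<in>range X. prob (X -` {v}) * ln (prob (X -` {v})))"
proof -
  have "fibers X = (\<lambda>v. X -` {v}) ` range X"
    by (auto simp: fibers_def vimage_def image_image)
  moreover have "inj_on (\<lambda>v. X -` {v}) (range X)"
    by (rule inj_onI) blast
  ultimately show ?thesis
    unfolding partition_entropy_def by (simp add: sum.reindex)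
qed

text \<open>Expectations do the marginalisation: a sum over the values of a tuple whose summand
  depends on one component turns into the sum for that component without reindexing.\<close>

lemma sum_simple_eq_expectation:
  assumes "simple_function M X"
  shows "(\<Sum>v\<in>range X. prob (X -` {v}) * f v) = expectation (\<lambda>x. f (X x))"
proof -
  have fin: "finite (range X)" using simple_functionD(1)[OF assms] by simp
  have "f (X x) = (\<Sum>v\<in>range X. indicator (X -` {v}) x * f v)" for x
  proof -
    have "(\<Sum>v\<in>range X. indicator (X -` {v}) x * f v) = (\<Sum>v\<in>range X. if v = X x then f v else 0)"
      by (rule sum.cong) (auto simp: indicator_def)
    then show ?thesis using fin by simp
  qed
  then have "expectation (\<lambda>x. f (X x)) = expectation (\<lambda>x. \<Sum>v\<in>range X. indicator (X -` {v}) x * f v)"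
    by presburger
  also have "\<dots> = (\<Sum>v\<in>range X. expectation (\<lambda>x. indicator (X -` {v}) x * f v))"
    by (rule Bochner_Integration.integral_sum)
       (auto intro!: integrable_mult_left integrable_real_indicator vimage_in_sets_simple[OF assms] simp: less_top[symmetric])
  also have "\<dots> = (\<Sum>v\<in>range X. prob (X -` {v}) * f v)"
    by (simp add: vimage_in_sets_simple[OF assms])
  finally show ?thesis by simp
qed

lemma ent_eq_expectation:
  assumes "simple_function M X"
  shows "ent X = - expectation (\<lambda>x. ln (prob (X -` {X x})))"
  using sum_simple_eq_expectation[OF assms, of "\<lambda>v. ln (prob (X -` {v}))"]
  by (simp add: ent_eq_sum[OF assms])


text \<open>This is the nonnegativity of the conditional mutual information of \<open>X\<close> and
  \<open>Y\<close> given \<open>Z\<close>. All later inequalities for conditional entropy rest on it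
  or on \<open>ent_mono\<close>.\<close>

lemma ent_submodular:
  fixes X :: "'s \<Rightarrow> 'b" and Y :: "'s \<Rightarrow> 'c" and Z :: "'s \<Rightarrow> 'd"
  assumes X: "simple_function M X" and Y: "simple_function M Y" and Z: "simple_function M Z"
  shows "ent (\<lambda>x. (X x, Y x, Z x)) + ent Z \<le> ent (\<lambda>x. (X x, Z x)) + ent (\<lambda>x. (Y x, Z x))"
proof -
  \<comment> \<open>Base \<open>exp 1\<close> turns the library's \<open>log\<close> into the
    \<open>ln\<close> of \<open>partition_entropy\<close>.\<close>
  interpret information_space M "exp 1" by unfold_locales simp
  note sd = simple_distributedI[OF _ measure_nonneg refl]
  let ?T = "\<lambda>x. (X x, Y x, Z x)" and ?XZ = "\<lambda>x. (X x, Z x)" and ?YZ = "\<lambda>x. (Y x, Z x)"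
  have T: "simple_function M ?T" and XZ: "simple_function M ?XZ" and YZ: "simple_function M ?YZ"
    using X Y Z by simp_all
  let ?p = "\<lambda>V v. prob (V -` {v})"
  let ?L = "\<lambda>t. ln (prob (?T -` {t})) + ln (prob (Z -` {snd (snd t)}))
              - ln (prob (?XZ -` {(fst t, snd (snd t))})) - ln (prob (?YZ -` {(fst (snd t), snd (snd t))}))"
  \<comment> \<open>A null cell contributes 0 to both sides. Otherwise the marginal cells contain
    it, hence have positive probability, and the logarithm splits.\<close>
  have pointwise: "prob (?T -` {t}) * log (exp 1) (prob (?T -` {t}) /
      (prob (?XZ -` {(fst t, snd (snd t))}) * (prob (?YZ -` {(fst (snd t), snd (snd t))}) / prob (Z -` {snd (snd t)}))))
     = prob (?T -` {t}) * ?L t" for t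
  proof (cases "prob (?T -` {t}) = 0")
    case False
    then have pos: "0 < prob (?T -` {t})" using measure_nonneg[of M] by (simp add: less_le)
    have p: "0 < prob A" if "?T -` {t} \<subseteq> A" "A \<in> sets M" for A
      using pos finite_measure_mono[OF that] by linarith
    have "0 < prob (Z -` {snd (snd t)})" "0 < prob (?XZ -` {(fst t, snd (snd t))})"
      "0 < prob (?YZ -` {(fst (snd t), snd (snd t))})"
      by (rule p; force intro!: vimage_in_sets_simple X Y Z XZ YZ)+
    with pos show ?thesis
      by (simp add: log_def ln_mult ln_div)
  qed simp
  let ?I = "conditional_mutual_information (exp 1) (count_space (range X)) (count_space (range Y))
    (count_space (range Z)) X Y Z"
  have "0 \<le> ?I" using conditional_mutual_information_nonneg[OF X Y Z] by simp
  also have "?I = (\<Sum>t\<in>range ?T. prob (?T -` {t}) * log (exp 1) (prob (?T -` {t}) /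
      (prob (?XZ -` {(fst t, snd (snd t))}) * (prob (?YZ -` {(fst (snd t), snd (snd t))}) / prob (Z -` {snd (snd t)})))))"
    using conditional_mutual_information_eq[OF sd[OF Z] sd[OF YZ] sd[OF XZ] sd[OF T]]
    by (simp add: case_prod_unfold)
  also have "\<dots> = (\<Sum>t\<in>range ?T. prob (?T -` {t}) * ?L t)"
    by (simp only: pointwise)
  also have "\<dots> = (\<Sum>t\<in>range ?T. prob (?T -` {t}) * ln (prob (?T -` {t})))
      + (\<Sum>t\<in>range ?T. prob (?T -` {t}) * ln (prob (Z -` {snd (snd t)})))
      - (\<Sum>t\<in>range ?T. prob (?T -` {t}) * ln (prob (?XZ -` {(fst t, snd (snd t))})))
      - (\<Sum>t\<in>range ?T. prob (?T -` {t}) * ln (prob (?YZ -` {(fst (snd t), snd (snd t))})))"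
    by (simp add: algebra_simps sum.distrib sum_subtractf)
  also have "\<dots> = - ent ?T - ent Z + ent ?XZ + ent ?YZ"
    unfolding sum_simple_eq_expectation[OF T]
    by (simp add: ent_eq_expectation T Z XZ YZ)
  finally show ?thesis by linarith
qed

text \<open>Data processing: the hypothesis says that \<open>Y\<close> is a function of
  \<open>X\<close>.\<close>

lemma ent_mono:
  fixes X :: "'s \<Rightarrow> 'b" and Y :: "'s \<Rightarrow> 'c"
  assumes X: "simple_function M X"
    and fac: "\<And>x y. X x = X y \<Longrightarrow> Y x = Y y"
  shows "ent Y \<le> ent X"
proof -
  interpret information_space M "exp 1" by unfold_locales simp
  note sd = simple_distributedI[OF _ measure_nonneg refl]
  have H: "entropy (exp 1) (count_space (range V)) V = ent V" if V: "simple_function M V" for V :: "'s \<Rightarrow> 'v"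
    using entropy_simple_distributed[OF sd[OF V]] by (simp add: ent_eq_sum[OF V] log_def)
  obtain g where "Y = g \<circ> X" using factor_through[of X Y] fac by blast
  then show ?thesis
    using entropy_data_processing[OF X, of g] H[OF X] H[OF simple_function_compose[OF X, of g]] by simp
qed

lemma simple_function_factor:
  assumes X: "simple_function M X"
    and fac: "\<And>x y. X x = X y \<Longrightarrow> Y x = Y y"
  shows "simple_function M Y"
proof -
  obtain g where "Y = g \<circ> X" using factor_through[of X Y] fac by blast
  then show ?thesis using X by simp
qed

lemma ent_const [simp]: "ent (\<lambda>_. c) = 0"
  by (subst ent_eq_sum) (simp_all add: prob_space[unfolded space_UNIV])

lemma ent_nonneg:
  assumes "simple_function M X" shows "0 \<le> ent X"
  using ent_mono[OF assms, of "\<lambda>_. ()"] by simp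

text \<open>Submodularity with a trivial third variable.\<close>

lemma ent_Pair_le:
  assumes "simple_function M X" "simple_function M Y"
  shows "ent (\<lambda>x. (X x, Y x)) \<le> ent X + ent Y"
proof -
  have "fibers (\<lambda>x. (X x, Y x, ())) = fibers (\<lambda>x. (X x, Y x))"
    "fibers (\<lambda>x. (X x, ())) = fibers X" "fibers (\<lambda>x. (Y x, ())) = fibers Y"
    by (rule fibers_cong; simp)+
  then show ?thesis
    using ent_submodular[OF assms simple_function_const[of M "()"]] by simp
qed

lemma ent_invariant:
  assumes X: "simple_function M X" and T: "invariant_under M T"
  shows "ent (\<lambda>x. X (T x)) = ent X"
proof -
  have meas: "T \<in> measurable M M" and distr: "distr M M T = M"
    using T by (auto simp: invariant_under_def)
  note XT = simple_function_comp_measurable[OF X meas]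
  have prob: "prob ((\<lambda>x. X (T x)) -` {v}) = prob (X -` {v})" for v
    using measure_distr[OF meas vimage_in_sets_simple[OF X, of "{v}"]]
    by (simp add: distr vimage_def)
  have "ent X = - expectation (\<lambda>x. ln (prob (X -` {X x})))" by (rule ent_eq_expectation[OF X])
  also have "expectation (\<lambda>x. ln (prob (X -` {X x}))) = expectation (\<lambda>x. ln (prob (X -` {X (T x)})))"
  proof -
    have "(\<lambda>x. ln (prob (X -` {X x}))) \<in> borel_measurable M"
      by (rule borel_measurable_simple_function[OF simple_function_compose1[OF X]])
    from integral_distr[OF meas this] show ?thesis by (simp add: distr)
  qed
  finally show ?thesis by (simp add: ent_eq_expectation[OF XT] prob)
qed

section \<open>Conditional entropy\<close>

definition cond_ent :: "('s \<Rightarrow> 'v) \<Rightarrow> ('s \<Rightarrow> 'w) \<Rightarrow> real" where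
  "cond_ent X Y = ent (\<lambda>x. (X x, Y x)) - ent Y"

text \<open>As \<open>Z\<close> is a function of \<open>Y\<close>, adding it to a tuple that
  contains \<open>Y\<close> leaves the fibers unchanged, and submodularity reduces to the
  claim.\<close>

lemma cond_ent_antimono:
  assumes "simple_function M X" "simple_function M Y"
    and "\<And>x y. Y x = Y y \<Longrightarrow> Z x = Z y"
  shows "cond_ent X Y \<le> cond_ent X Z"
proof -
  have Z: "simple_function M Z"
    by (rule simple_function_factor[OF assms(2)]) (rule assms(3))
  have "Y x = Y y \<and> Z x = Z y \<longleftrightarrow> Y x = Y y" for x y
    using assms(3)[of x y] by auto
  then have "fibers (\<lambda>x. (X x, Y x, Z x)) = fibers (\<lambda>x. (X x, Y x))"
    and "fibers (\<lambda>x. (Y x, Z x)) = fibers Y"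
    by (auto simp add: fibers_def)
  then show ?thesis
    using ent_submodular[OF assms(1,2) Z] by (simp add: cond_ent_def)
qed

lemma cond_ent_Pair_le:
  assumes "simple_function M X" "simple_function M X'" "simple_function M Y"
  shows "cond_ent (\<lambda>x. (X x, X' x)) Y \<le> cond_ent X Y + cond_ent X' Y"
proof -
  have "fibers (\<lambda>x. ((X x, X' x), Y x)) = fibers (\<lambda>x. (X x, X' x, Y x))"
    by (rule fibers_cong) simp
  then show ?thesis
    using ent_submodular[OF assms] by (simp add: cond_ent_def)
qed

lemma cond_ent_mono:
  assumes "simple_function M X" "simple_function M Y"
    and "\<And>x y. X x = X y \<Longrightarrow> Z x = Z y"
  shows "cond_ent Z Y \<le> cond_ent X Y"
proof -
  have "ent (\<lambda>x. (Z x, Y x)) \<le> ent (\<lambda>x. (X x, Y x))"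
  proof (rule ent_mono)
    fix x y assume "(X x, Y x) = (X y, Y y)"
    then show "(Z x, Y x) = (Z y, Y y)" using assms(3)[of x y] by simp
  qed (use assms in simp)
  then show ?thesis by (simp add: cond_ent_def)
qed

lemma cond_ent_cong:
  assumes "\<And>x y. X x = X y \<longleftrightarrow> X' x = X' y"
  shows "cond_ent X Y = cond_ent X' Y"
proof -
  have "fibers (\<lambda>x. (X x, Y x)) = fibers (\<lambda>x. (X' x, Y x))"
    by (rule fibers_cong) (simp add: assms)
  then show ?thesis by (simp add: cond_ent_def)
qed

lemma cond_ent_invariant:
  assumes "simple_function M X" "simple_function M Y" "invariant_under M T"
  shows "cond_ent (\<lambda>x. X (T x)) (\<lambda>x. Y (T x)) = cond_ent X Y"
  using ent_invariant[OF assms(2,3)] ent_invariant[OF simple_function_Pair[OF assms(1,2)] assms(3)]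
  by (simp add: cond_ent_def)

lemma cond_ent_joint_le:
  assumes "finite I" "\<And>i. i \<in> I \<Longrightarrow> simple_function M (X i)" "simple_function M Y"
  shows "cond_ent (joint I X) Y \<le> (\<Sum>i\<in>I. cond_ent (X i) Y)"
  using assms(1,2)
proof (induction rule: finite_induct)
  case empty
  have "fibers (\<lambda>x. (joint {} X x, Y x)) = fibers Y"
    by (rule fibers_cong) (simp add: joint_eq_iff)
  then show ?case by (simp add: cond_ent_def)
next
  case (insert i I)
  have "cond_ent (joint (insert i I) X) Y = cond_ent (\<lambda>x. (X i x, joint I X x)) Y"
    by (rule cond_ent_cong) (simp add: joint_eq_iff)
  also have "\<dots> \<le> cond_ent (X i) Y + cond_ent (joint I X) Y"
    using insert assms(3) by (intro cond_ent_Pair_le simple_function_joint) auto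
  finally show ?case using insert by simp
qed

lemma cond_ent_unit: "cond_ent X (\<lambda>_. ()) = ent X"
  using fibers_cong[of "\<lambda>x. (X x, ())" X] by (simp add: cond_ent_def)

lemma ent_joint_le:
  assumes "finite I" "\<And>i. i \<in> I \<Longrightarrow> simple_function M (X i)"
  shows "ent (joint I X) \<le> (\<Sum>i\<in>I. ent (X i))"
  using cond_ent_joint_le[of I X "\<lambda>_. ()"] assms by (simp add: cond_ent_unit)

lemma ent_le_ent_add_cond_ent:
  assumes "simple_function M X" "simple_function M Y"
  shows "ent X \<le> ent Y + cond_ent X Y"
proof -
  have "ent X \<le> ent (\<lambda>x. (X x, Y x))"
    using assms by (intro ent_mono) auto
  then show ?thesis by (simp add: cond_ent_def)
qed

text \<open>Given all the \<open>Y i\<close>, each \<open>X i\<close> costs at most its entropy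
  given the single \<open>Y i\<close>, because conditioning on more lowers the entropy. The errors
  add up over \<open>I\<close>.\<close>

lemma ent_joint_comp_le:
  assumes fin: "finite I"
    and X: "\<And>i. i \<in> I \<Longrightarrow> simple_function M (X i)" and Y: "\<And>i. i \<in> I \<Longrightarrow> simple_function M (Y i)"
    and D: "\<And>i. i \<in> I \<Longrightarrow> cond_ent (X i) (Y i) \<le> d"
  shows "ent (joint I X) \<le> ent (joint I Y) + real (card I) * d"
proof -
  have sX: "simple_function M (joint I X)" and sY: "simple_function M (joint I Y)"
    using assms by (auto intro!: simple_function_joint)
  have "ent (joint I X) \<le> ent (joint I Y) + cond_ent (joint I X) (joint I Y)"
    by (rule ent_le_ent_add_cond_ent[OF sX sY])
  also have "cond_ent (joint I X) (joint I Y) \<le> (\<Sum>i\<in>I. cond_ent (X i) (joint I Y))"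
    using assms sY by (intro cond_ent_joint_le) auto
  also have "\<dots> \<le> (\<Sum>i\<in>I. d)"
  proof (rule sum_mono)
    fix i assume i: "i \<in> I"
    have "cond_ent (X i) (joint I Y) \<le> cond_ent (X i) (Y i)"
      using i X sY by (intro cond_ent_antimono) (auto simp: joint_eq_iff)
    with D[OF i] show "cond_ent (X i) (joint I Y) \<le> d" by linarith
  qed
  finally show ?thesis by simp
qed

end

section \<open>Approximation by cylinders\<close>

context prob_space_UNIV
begin

text \<open>A crude bound on the binary entropy; what matters is that it tends to 0 with the measure
  of \<open>A\<close>.\<close>

lemma ent_indicator_le:
  assumes A: "A \<in> sets M"
  shows "ent (\<lambda>x. x \<in> A) \<le> 3 * sqrt (prob A)"
proof -
  define p where "p = prob A"
  have p: "0 \<le> p" "p \<le> 1" by (simp_all add: p_def)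
  have sf: "simple_function M (\<lambda>x. x \<in> A)"
    unfolding simple_function_eq_measurable using A by simp
  have "ent (\<lambda>x. x \<in> A) = - (\<Sum>v\<in>range (\<lambda>x. x \<in> A). prob ((\<lambda>x. x \<in> A) -` {v}) * ln (prob ((\<lambda>x. x \<in> A) -` {v})))"
    by (rule ent_eq_sum[OF sf])
  \<comment> \<open>Membership in \<open>A\<close> may be constant, so a missing truth value is
    added with empty preimage and summand 0.\<close>
  also have "(\<Sum>v\<in>range (\<lambda>x. x \<in> A). prob ((\<lambda>x. x \<in> A) -` {v}) * ln (prob ((\<lambda>x. x \<in> A) -` {v})))
      = (\<Sum>v\<in>UNIV. prob ((\<lambda>x. x \<in> A) -` {v}) * ln (prob ((\<lambda>x. x \<in> A) -` {v})))"
  proof (rule sum.mono_neutral_left)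
    show "\<forall>v\<in>UNIV - range (\<lambda>x. x \<in> A).
        prob ((\<lambda>x. x \<in> A) -` {v}) * ln (prob ((\<lambda>x. x \<in> A) -` {v})) = 0"
    proof
      fix v assume "v \<in> UNIV - range (\<lambda>x. x \<in> A)"
      then have "(\<lambda>x. x \<in> A) -` {v} = {}" by blast
      then show "prob ((\<lambda>x. x \<in> A) -` {v}) * ln (prob ((\<lambda>x. x \<in> A) -` {v})) = 0"
        by (simp only: measure_empty mult_zero_left)
    qed
  qed simp_all
  also have "\<dots> = p * ln p + (1 - p) * ln (1 - p)"
  proof -
    have "(\<lambda>x. x \<in> A) -` {True} = A" "(\<lambda>x. x \<in> A) -` {False} = space M - A" by auto
    moreover have "prob (space M - A) = 1 - p" using prob_compl[OF A] by (simp only: p_def)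
    ultimately show ?thesis by (simp only: UNIV_bool p_def) simp
  qed
  finally have eq: "ent (\<lambda>x. x \<in> A) = - (p * ln p) - (1 - p) * ln (1 - p)" by simp
  \<comment> \<open>Apply \<open>ln t \<le> t - 1\<close> at \<open>t = 1 / sqrt p\<close>; the next
    bound applies it at \<open>1 / (1 - p)\<close>.\<close>
  have 1: "- (p * ln p) \<le> 2 * sqrt p"
  proof (cases "p = 0")
    case False
    with p have pos: "0 < p" by simp
    have "ln (1 / sqrt p) \<le> 1 / sqrt p - 1" using pos by (intro ln_le_minus_one) simp
    moreover have "ln (1 / sqrt p) = - ln p / 2" using pos by (simp add: ln_div ln_sqrt)
    ultimately have "- ln p \<le> 2 * (1 / sqrt p)" by simp
    then have "p * (- ln p) \<le> p * (2 * (1 / sqrt p))" using pos by (intro mult_left_mono) auto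
    also have "\<dots> = 2 * (p / sqrt p)" by simp
    also have "p / sqrt p = sqrt p" using pos by (simp add: real_div_sqrt)
    finally show ?thesis by simp
  qed simp
  have 2: "- ((1 - p) * ln (1 - p)) \<le> p"
  proof (cases "p = 1")
    case False
    with p have pos: "0 < 1 - p" by simp
    have "ln (1 / (1 - p)) \<le> 1 / (1 - p) - 1" using pos by (intro ln_le_minus_one) simp
    moreover have "ln (1 / (1 - p)) = - ln (1 - p)" using pos by (simp add: ln_div)
    ultimately have "(1 - p) * (- ln (1 - p)) \<le> (1 - p) * (1 / (1 - p) - 1)"
      using pos by (intro mult_left_mono) auto
    also have "\<dots> = p" using pos by (simp add: field_simps)
    finally show ?thesis by simp
  qed simp
  have "p \<le> sqrt p"
    using p by (intro real_le_rsqrt) (simp add: power2_eq_square mult_left_le)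
  with 1 2 eq show ?thesis by (simp add: p_def)
qed

text \<open>Membership in \<open>C\<close> and in the symmetric difference determines membership in
  \<open>B\<close>, so the conditional entropy is at most the entropy of the symmetric
  difference.\<close>

lemma cond_ent_indicator_le:
  assumes B: "B \<in> sets M" and C: "C \<in> sets M"
  shows "cond_ent (\<lambda>x. x \<in> B) (\<lambda>x. x \<in> C) \<le> 3 * sqrt (prob ((B - C) \<union> (C - B)))"
proof -
  let ?D = "(B - C) \<union> (C - B)"
  have D: "?D \<in> sets M" using B C by auto
  have sf: "simple_function M (\<lambda>x. x \<in> A)" if "A \<in> sets M" for A
    unfolding simple_function_eq_measurable using that by simp
  have "ent (\<lambda>x. (x \<in> B, x \<in> C)) \<le> ent (\<lambda>x. (x \<in> ?D, x \<in> C))"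
    using sf[OF D] sf[OF C] by (intro ent_mono) auto
  also have "\<dots> \<le> ent (\<lambda>x. x \<in> ?D) + ent (\<lambda>x. x \<in> C)"
    by (rule ent_Pair_le[OF sf[OF D] sf[OF C]])
  finally have "cond_ent (\<lambda>x. x \<in> B) (\<lambda>x. x \<in> C) \<le> ent (\<lambda>x. x \<in> ?D)" by (simp add: cond_ent_def)
  also have "\<dots> \<le> 3 * sqrt (prob ?D)" by (rule ent_indicator_le[OF D])
  finally show ?thesis .
qed

end

section \<open>Squares, cylinders and the product topology\<close>

lemma restrict_eq_iff: "restrict x D = restrict y D \<longleftrightarrow> (\<forall>u\<in>D. x u = y u)"
  by (auto simp: restrict_def fun_eq_iff)

lemma square_mono: "m \<le> n \<Longrightarrow> square m \<subseteq> square n"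
  by (auto simp: square_def)

lemma finite_square [simp]: "finite (square n)"
  by (simp add: square_def)

lemma finite_subset_square:
  assumes "finite J"
  obtains m where "J \<subseteq> square m"
proof -
  have "\<exists>m. J \<subseteq> square m" using assms
  proof (induction rule: finite_induct)
    case (insert v J)
    then obtain m where m: "J \<subseteq> square m" by blast
    obtain i j where v: "v = (i, j)" by (cases v)
    define k where "k = nat \<bar>i\<bar> + nat \<bar>j\<bar>"
    have "v \<in> square k" unfolding v square_def k_def by auto
    then have "insert v J \<subseteq> square (max m k)"
      using m square_mono[of m "max m k"] square_mono[of k "max m k"] by auto
    then show ?case by blast
  qed simp
  then show ?thesis using that by blast
qed

definition cylinder_on :: "(int \<times> int) set \<Rightarrow> 'a config set \<Rightarrow> bool" where
  "cylinder_on D C \<longleftrightarrow> (\<forall>x y. restrict x D = restrict y D \<longrightarrow> x \<in> C \<longrightarrow> y \<in> C)"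

lemma cylinder_onD: "cylinder_on D C \<Longrightarrow> restrict x D = restrict y D \<Longrightarrow> x \<in> C \<longleftrightarrow> y \<in> C"
  unfolding cylinder_on_def by metis

lemma cylinder_on_mono: "cylinder_on D C \<Longrightarrow> D \<subseteq> D' \<Longrightarrow> cylinder_on D' C"
  unfolding cylinder_on_def restrict_eq_iff by blast

lemma cylinder_on_UN: "(\<And>i. i \<in> I \<Longrightarrow> cylinder_on D (C i)) \<Longrightarrow> cylinder_on D (\<Union>i\<in>I. C i)"
  unfolding cylinder_on_def by blast

text \<open>A basic open neighbourhood restricts only finitely many coordinates, and these lie in
  some square.\<close>

lemma openin_config_topology_cylinder:
  assumes U: "openin config_topology U" and x: "x \<in> U"
  obtains m where "\<And>y. restrict y (square m) = restrict x (square m) \<Longrightarrow> y \<in> U"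
proof -
  obtain V where V: "finite {i. V i \<noteq> UNIV}" "x \<in> Pi\<^sub>E UNIV V" "Pi\<^sub>E UNIV V \<subseteq> U"
    using U x unfolding config_topology_def openin_product_topology_alt by force
  obtain m where m: "{i. V i \<noteq> UNIV} \<subseteq> square m" by (rule finite_subset_square[OF V(1)])
  have "y \<in> U" if "restrict y (square m) = restrict x (square m)" for y
  proof -
    have "y i \<in> V i" for i
    proof (cases "i \<in> square m")
      case True
      with that have "y i = x i" by (simp add: restrict_eq_iff)
      then show ?thesis using PiE_mem[OF V(2), of i] by simp
    next
      case False
      with m show ?thesis by blast
    qed
    then show ?thesis using V(3) by (auto simp: PiE_iff)
  qed
  then show ?thesis using that by blast
qed

locale config_prob = prob_space M for M :: "('a::finite) config measure" +
  assumes sets_config: "sets M = sets config_borel"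
begin

lemma space_config: "space M = UNIV"
  using sets_eq_imp_space_eq[OF sets_config] by (simp add: config_borel_def)

sublocale prob_space_UNIV M
  by unfold_locales (rule space_config)

lemma sets_config_sigma: "sets M = sigma_sets UNIV {U. openin config_topology U}"
  by (simp add: sets_config config_borel_def)

lemma simple_function_coordinate: "simple_function M (\<lambda>x. x u)"
  unfolding simple_function_def
proof safe
  fix x :: "'a config"
  have "openin config_topology {y \<in> topspace config_topology. y u \<in> {x u}}"
    unfolding config_topology_def
    by (rule openin_continuous_map_preimage[OF continuous_map_product_projection]) auto
  then have "{y. y u = x u} \<in> sets M"
    unfolding sets_config_sigma by (intro sigma_sets.Basic) (simp add: config_topology_def)
  then show "(\<lambda>x. x u) -` {x u} \<inter> space M \<in> sets M" by (simp add: vimage_def)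
qed simp

lemma simple_function_restrict:
  assumes "finite D" shows "simple_function M (\<lambda>x. restrict x D)"
  using simple_function_joint[OF assms, of "\<lambda>u x. x u"] simple_function_coordinate
  by (simp add: joint_def[abs_def])

lemma cylinder_on_sets:
  assumes "finite D" "cylinder_on D C"
  shows "C \<in> sets M"
proof -
  have "(\<lambda>x. restrict x D) -` ((\<lambda>x. restrict x D) ` C) = C"
  proof (intro equalityI subsetI)
    fix x assume "x \<in> (\<lambda>x. restrict x D) -` ((\<lambda>x. restrict x D) ` C)"
    then obtain y where "restrict x D = restrict y D" "y \<in> C" by blast
    then show "x \<in> C" using cylinder_onD[OF assms(2)] by blast
  qed blast
  then show ?thesis
    using vimage_in_sets_simple[OF simple_function_restrict[OF assms(1)], of "(\<lambda>x. restrict x D) ` C"]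
    by simp
qed

text \<open>Measurability is included so that the closure properties below can drive an induction
  over the generated sigma-algebra.\<close>

definition approximable :: "'a config set \<Rightarrow> bool" where
  "approximable A \<longleftrightarrow> A \<in> sets M \<and>
     (\<forall>e>0. \<exists>m C. cylinder_on (square m) C \<and> prob ((A - C) \<union> (C - A)) < e)"

lemma approximable_cylinder: "cylinder_on (square m) C \<Longrightarrow> approximable C"
  unfolding approximable_def using cylinder_on_sets[OF finite_square] by force

lemma approximable_compl:
  assumes "approximable A" shows "approximable (UNIV - A)"
  unfolding approximable_def
proof (intro conjI allI impI)
  have "space M - A \<in> sets M"
    by (rule sets.compl_sets) (use assms in \<open>simp add: approximable_def\<close>)
  then show "UNIV - A \<in> sets M" by simp
  fix e :: real assume "0 < e"
  then obtain m C where C: "cylinder_on (square m) C" "prob ((A - C) \<union> (C - A)) < e"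
    using assms unfolding approximable_def by blast
  have "(UNIV - A - - C) \<union> (- C - (UNIV - A)) = (A - C) \<union> (C - A)" by blast
  then have "prob ((UNIV - A - - C) \<union> (- C - (UNIV - A))) < e" using C(2) by simp
  moreover have "cylinder_on (square m) (- C)"
    unfolding cylinder_on_def Compl_iff using cylinder_onD[OF C(1)] by blast
  ultimately show "\<exists>m C. cylinder_on (square m) C \<and> prob ((UNIV - A - C) \<union> (C - (UNIV - A))) < e"
    by (intro exI conjI)
qed

text \<open>Continuity from below cuts the union down to \<open>k\<close> sets at a cost below
  \<open>e / 2\<close>; replacing these \<open>k\<close> sets by cylinders costs at most another
  \<open>e / 2\<close>.\<close>

lemma approximable_UN:
  fixes A :: "nat \<Rightarrow> 'a config set"
  assumes A: "\<And>i. approximable (A i)"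
  shows "approximable (\<Union>i. A i)"
  unfolding approximable_def
proof (intro conjI allI impI)
  have Am: "A i \<in> sets M" for i using A unfolding approximable_def by blast
  then show Um: "(\<Union>i. A i) \<in> sets M" by auto
  fix e :: real assume e: "0 < e"
  define U where "U k = (\<Union>i<k. A i)" for k
  have Ukm: "U k \<in> sets M" for k using Am unfolding U_def by auto
  have "(\<lambda>k. prob (U k)) \<longlonglongrightarrow> prob (\<Union>k. U k)"
  proof (rule finite_Lim_measure_incseq)
    show "incseq U" unfolding U_def by (intro monoI UN_mono) auto
  qed (use Ukm in auto)
  also have "(\<Union>k. U k) = (\<Union>i. A i)" unfolding U_def by auto
  finally have "eventually (\<lambda>k. prob (\<Union>i. A i) - e / 2 < prob (U k)) sequentially"
    using e by (auto dest!: order_tendstoD(1)[where a="prob (\<Union>i. A i) - e / 2"])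
  then obtain k where k: "prob (\<Union>i. A i) - e / 2 < prob (U k)"
    unfolding eventually_sequentially by blast
  have "U k \<subseteq> (\<Union>i. A i)" unfolding U_def by blast
  then have tail: "prob ((\<Union>i. A i) - U k) < e / 2"
    using k finite_measure_Diff[OF Um Ukm] by simp
  \<comment> \<open>The summand 1 keeps \<open>d\<close> well defined and positive when
    \<open>k = 0\<close>.\<close>
  define d where "d = e / (2 * (real k + 1))"
  have "0 < d" using e unfolding d_def by simp
  then have "\<forall>i. \<exists>m C. cylinder_on (square m) C \<and> prob ((A i - C) \<union> (C - A i)) < d"
    using A unfolding approximable_def by blast
  then obtain m C where C: "\<And>i. cylinder_on (square (m i)) (C i)"
    "\<And>i. prob ((A i - C i) \<union> (C i - A i)) < d" by metis
  \<comment> \<open>The sum serves as a common upper bound for the finitely many side parameters, so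
    all the cylinders live on one square.\<close>
  define m' where "m' = (\<Sum>i<k. m i)"
  define C' where "C' = (\<Union>i<k. C i)"
  have Cm: "C i \<in> sets M" for i using cylinder_on_sets[OF finite_square C(1)] .
  have "cylinder_on (square m') (C i)" if "i < k" for i
  proof (rule cylinder_on_mono[OF C(1) square_mono])
    show "m i \<le> m'" unfolding m'_def using that by (intro member_le_sum) auto
  qed
  then have cyl: "cylinder_on (square m') C'" unfolding C'_def by (intro cylinder_on_UN) auto
  have sub: "((\<Union>i. A i) - C') \<union> (C' - (\<Union>i. A i))
      \<subseteq> ((\<Union>i. A i) - U k) \<union> (\<Union>i<k. (A i - C i) \<union> (C i - A i))"
    unfolding C'_def U_def by blast
  have "prob (((\<Union>i. A i) - C') \<union> (C' - (\<Union>i. A i)))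
      \<le> prob (((\<Union>i. A i) - U k) \<union> (\<Union>i<k. (A i - C i) \<union> (C i - A i)))"
    using sub Um Ukm Am Cm by (intro finite_measure_mono) auto
  also have "\<dots> \<le> prob ((\<Union>i. A i) - U k) + prob (\<Union>i<k. (A i - C i) \<union> (C i - A i))"
    using Um Ukm Am Cm by (intro measure_Un_le) auto
  also have "prob (\<Union>i<k. (A i - C i) \<union> (C i - A i)) \<le> (\<Sum>i<k. prob ((A i - C i) \<union> (C i - A i)))"
    using Am Cm by (intro measure_UNION_le) auto
  also have "\<dots> \<le> (\<Sum>i<k. d)" using C(2) by (intro sum_mono less_imp_le)
  also have "\<dots> \<le> e / 2" using e by (simp add: d_def field_simps)
  finally have "prob (((\<Union>i. A i) - C') \<union> (C' - (\<Union>i. A i))) < e" using tail by simp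
  with cyl show "\<exists>m C. cylinder_on (square m) C \<and> prob (((\<Union>i. A i) - C) \<union> (C - (\<Union>i. A i))) < e"
    by blast
qed

lemma approximable_open:
  assumes U: "openin config_topology U" shows "approximable U"
proof -
  \<comment> \<open>\<open>C m\<close> is the largest cylinder over \<open>square m\<close> inside
    \<open>U\<close>. Indexing by \<open>m\<close> rather than by points makes the union
    countable.\<close>
  define C where "C m = {x. \<forall>y. restrict y (square m) = restrict x (square m) \<longrightarrow> y \<in> U}" for m
  have "x \<in> (\<Union>m. C m)" if x: "x \<in> U" for x
  proof -
    obtain m where "\<And>y. restrict y (square m) = restrict x (square m) \<Longrightarrow> y \<in> U"
      using openin_config_topology_cylinder[OF U x] by blast
    then have "x \<in> C m" unfolding C_def by simp
    then show ?thesis by blast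
  qed
  moreover have "C m \<subseteq> U" for m unfolding C_def by auto
  ultimately have "U = (\<Union>m. C m)" by blast
  moreover have "approximable (C m)" for m
    by (rule approximable_cylinder[of m]) (simp add: cylinder_on_def C_def)
  ultimately show ?thesis using approximable_UN by simp
qed

lemma approximable_sets:
  assumes "A \<in> sets M" shows "approximable A"
proof -
  have "A \<in> sigma_sets UNIV {U. openin config_topology U}"
    using assms by (simp only: sets_config_sigma)
  then show ?thesis
  proof (induction rule: sigma_sets.induct)
    case Empty
    show ?case by (rule approximable_cylinder[of 0]) (simp add: cylinder_on_def)
  next
    case (Basic U)
    then show ?case by (intro approximable_open) simp
  qed (blast intro: approximable_compl, blast intro: approximable_UN)
qed

text \<open>The cells are treated one at a time: each is close in measure to a cylinder, and one
  large square determines all these cylinders.\<close>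

lemma cond_ent_cylinders_small:
  assumes P: "finite_measurable_partition M P"
    and X: "range X = P" "\<And>x B. B \<in> P \<Longrightarrow> X x = B \<longleftrightarrow> x \<in> B"
    and e: "0 < e"
  obtains m where "cond_ent X (\<lambda>x. restrict x (square m)) < e"
proof -
  have fin: "finite P" and meas: "\<And>B. B \<in> P \<Longrightarrow> B \<in> sets M"
    using P by (auto simp: finite_measurable_partition_def)
  \<comment> \<open>With \<open>card P + 1\<close> the sum of \<open>card P\<close> errors
    \<open>e / c\<close> is strictly below \<open>e\<close>; \<open>d\<close> is the measure error
    for which \<open>3 * sqrt d\<close> equals \<open>e / c\<close>.\<close>
  define c where "c = real (card P) + 1"
  define d where "d = (e / (3 * c))\<^sup>2"
  have c: "0 < c" by (simp add: c_def)
  have d: "0 < d" using e c by (simp add: d_def)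
  have sqd: "3 * sqrt d = e / c"
    using e c by (simp add: d_def)
  have "\<forall>B\<in>P. \<exists>m C. cylinder_on (square m) C \<and> prob ((B - C) \<union> (C - B)) < d"
    using approximable_sets[OF meas] d unfolding approximable_def by blast
  then obtain m C where C: "\<And>B. B \<in> P \<Longrightarrow> cylinder_on (square (m B)) (C B)"
    "\<And>B. B \<in> P \<Longrightarrow> prob ((B - C B) \<union> (C B - B)) < d" by metis
  define m' where "m' = (\<Sum>B\<in>P. m B)"
  let ?Y = "\<lambda>x :: 'a config. restrict x (square m')"
  have Y: "simple_function M ?Y" by (rule simple_function_restrict) simp
  have sf: "simple_function M (\<lambda>x. x \<in> A)" if "A \<in> sets M" for A
    unfolding simple_function_eq_measurable using that by simp
  have le: "cond_ent (\<lambda>x. x \<in> B) ?Y \<le> e / c" if B: "B \<in> P" for B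
  proof -
    have CB: "cylinder_on (square m') (C B)"
    proof (rule cylinder_on_mono[OF C(1)[OF B] square_mono])
      show "m B \<le> m'" unfolding m'_def using that fin by (intro member_le_sum) auto
    qed
    have "cond_ent (\<lambda>x. x \<in> B) ?Y \<le> cond_ent (\<lambda>x. x \<in> B) (\<lambda>x. x \<in> C B)"
      by (rule cond_ent_antimono[OF sf[OF meas[OF B]] Y]) (rule cylinder_onD[OF CB])
    also have "\<dots> \<le> 3 * sqrt (prob ((B - C B) \<union> (C B - B)))"
      by (rule cond_ent_indicator_le[OF meas[OF B] cylinder_on_sets[OF finite_square CB]])
    also have "\<dots> \<le> 3 * sqrt d" using C(2)[OF B] by simp
    finally show ?thesis by (simp only: sqd)
  qed
  let ?J = "joint P (\<lambda>B x. x \<in> B)"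
  have J: "simple_function M ?J" using fin sf meas by (intro simple_function_joint) auto
  have "cond_ent X ?Y \<le> cond_ent ?J ?Y"
  proof (rule cond_ent_mono[OF J Y])
    fix x y assume "?J x = ?J y"
    then have *: "\<forall>B\<in>P. x \<in> B \<longleftrightarrow> y \<in> B" by (simp add: joint_eq_iff)
    have XP: "X y \<in> P" using X(1) by blast
    then have "y \<in> X y" using X(2)[OF XP, of y] by simp
    with * XP have "x \<in> X y" by blast
    then show "X x = X y" using X(2)[OF XP, of x] by simp
  qed
  also have "\<dots> \<le> (\<Sum>B\<in>P. cond_ent (\<lambda>x. x \<in> B) ?Y)"
    using fin sf meas Y by (intro cond_ent_joint_le) auto
  also have "\<dots> \<le> (\<Sum>B\<in>P. e / c)" by (rule sum_mono) (rule le)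
  also have "\<dots> < e" using e c by (simp add: field_simps c_def)
  finally show ?thesis by (rule that)
qed

end

section \<open>Dynamical entropy of frames\<close>

lemma invariant_under_comp:
  assumes "invariant_under M S" "invariant_under M T"
  shows "invariant_under M (\<lambda>x. S (T x))"
proof -
  have S: "S \<in> measurable M M" "distr M M S = M" and T: "T \<in> measurable M M" "distr M M T = M"
    using assms by (auto simp: invariant_under_def)
  have "distr M M (S \<circ> T) = M"
    using distr_distr[OF S(1) T(1)] by (simp add: S(2) T(2))
  moreover have "S \<circ> T \<in> measurable M M" using T(1) S(1) by (rule measurable_comp)
  ultimately show ?thesis by (simp add: invariant_under_def comp_def)
qed

lemma invariant_under_funpow:
  assumes "invariant_under M F" shows "invariant_under M (F ^^ i)"
proof (induction i)
  case 0
  show ?case by (simp add: invariant_under_def id_def)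
next
  case (Suc i)
  then show ?case using invariant_under_comp[OF assms Suc] by (simp add: comp_def)
qed

text \<open>This symmetry absorbs the minus sign from \<open>shift_image_fibers\<close>.\<close>

lemma uminus_in_frame_iff [simp]: "- v \<in> frame r n \<longleftrightarrow> v \<in> frame r n"
  by (cases v) (auto simp: frame_def square_def)

lemma finite_frame [simp]: "finite (frame r n)"
  by (simp add: frame_def)

lemma card_frame_le:
  assumes "r \<le> n" "1 \<le> n"
  shows "real (card (frame r n)) \<le> 12 * real r * real n"
proof -
  have sq: "real (card (square k)) = (2 * real k + 1) * (2 * real k + 1)" for k
  proof -
    have "nat (2 * int k + 1) = 2 * k + 1" by linarith
    then show ?thesis by (simp add: square_def card_cartesian_product algebra_simps)
  qed
  have "card (frame r n) = card (square n) - card (square (n - r))"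
    unfolding frame_def by (intro card_Diff_subset square_mono) auto
  moreover have "card (square (n - r)) \<le> card (square n)"
    by (intro card_mono square_mono) auto
  ultimately have "real (card (frame r n)) = real (card (square n)) - real (card (square (n - r)))"
    by (simp add: of_nat_diff)
  also have "\<dots> = (2 * real n + 1) * (2 * real n + 1) - (2 * (real n - real r) + 1) * (2 * (real n - real r) + 1)"
    by (simp only: sq of_nat_diff[OF assms(1)])
  also have "\<dots> = real r * (8 * real n + 4 - 4 * real r)"
    by (simp add: algebra_simps)
  \<comment> \<open>Here \<open>1 \<le> n\<close> absorbs the constant 4 into
    \<open>4 * n\<close>.\<close>
  also have "\<dots> \<le> real r * (12 * real n)"
    using assms by (intro mult_left_mono) auto
  finally show ?thesis by simp
qed

lemma frame_partition_origin:
  "frame_partition r n (origin_partition :: 'a config set set) = fibers (\<lambda>x. restrict x (frame r n))"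
  unfolding origin_partition_fibers frame_partition_fibers
proof (rule fibers_cong)
  fix x y :: "'a config"
  have "(\<forall>v\<in>frame r n. x (- v) = y (- v)) \<longleftrightarrow> (\<forall>v\<in>frame r n. x v = y v)"
    by (metis minus_minus uminus_in_frame_iff)
  then show "joint (frame r n) (\<lambda>v x. shift (- v) x (0, 0)) x = joint (frame r n) (\<lambda>v x. shift (- v) x (0, 0)) y
      \<longleftrightarrow> restrict x (frame r n) = restrict y (frame r n)"
    by (simp add: joint_eq_iff restrict_eq_iff shift_def flip: zero_prod_def)
qed

lemma radius_determines_square:
  assumes F: "has_radius F r" and k: "r \<le> k"
    and init: "restrict x (square k) = restrict y (square k)"
    and fr: "\<And>i. i < N \<Longrightarrow> restrict ((F ^^ i) x) (frame r k) = restrict ((F ^^ i) y) (frame r k)"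
    and i: "i < N"
  shows "restrict ((F ^^ i) x) (square k) = restrict ((F ^^ i) y) (square k)"
  using i
proof (induction i)
  case 0
  then show ?case using init by simp
next
  case (Suc i)
  obtain f where f: "\<And>x z. F x z = f (restrict (\<lambda>u. x (z + u)) (square r))"
    using F unfolding has_radius_def by blast
  have IH: "(F ^^ i) x u = (F ^^ i) y u" if "u \<in> square k" for u
    using Suc that unfolding restrict_eq_iff by simp
  have "(F ^^ Suc i) x z = (F ^^ Suc i) y z" if z: "z \<in> square k" for z
  proof (cases "z \<in> frame r k")
    case True
    then show ?thesis using fr[OF Suc.prems] unfolding restrict_eq_iff by blast
  next
    case False
    with z have z': "z \<in> square (k - r)" by (simp add: frame_def)
    \<comment> \<open>Because \<open>r \<le> k\<close>, the subtraction \<open>k - r\<close> is not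
      truncated, and the neighbourhood of an interior site stays inside the square.\<close>
    have "z + u \<in> square k" if "u \<in> square r" for u
      using z' that k by (cases z; cases u) (auto simp: square_def of_nat_diff)
    then have "restrict (\<lambda>u. (F ^^ i) x (z + u)) (square r) = restrict (\<lambda>u. (F ^^ i) y (z + u)) (square r)"
      using IH by (simp add: restrict_eq_iff)
    then show ?thesis using f[of "(F ^^ i) x" z] f[of "(F ^^ i) y" z] by simp
  qed
  then show ?case unfolding restrict_eq_iff by blast
qed

section \<open>Dynamical entropy for a bi-invariant measure\<close>

locale bi_invariant_ca = config_prob M for M :: "('a::finite) config measure" +
  fixes F :: "'a config \<Rightarrow> 'a config" and r :: nat
  assumes radius: "has_radius F r"
    and invariant_F: "invariant_under M F"
    and invariant_shift: "invariant_under M (shift v)"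
begin

text \<open>Its fibers form the \<open>N\<close>-step refinement that appears in
  \<open>dynamical_entropy\<close>.\<close>

definition orbit :: "nat \<Rightarrow> ('a config \<Rightarrow> 'v) \<Rightarrow> 'a config \<Rightarrow> nat \<Rightarrow> 'v" where
  "orbit N X = joint {..<N} (\<lambda>i x. X ((F ^^ i) x))"

lemma orbit_eq_iff: "orbit N X x = orbit N X y \<longleftrightarrow> (\<forall>i<N. X ((F ^^ i) x) = X ((F ^^ i) y))"
  by (simp add: orbit_def joint_eq_iff Ball_def)

lemma invariant_funpow: "invariant_under M (F ^^ i)"
  by (rule invariant_under_funpow[OF invariant_F])

lemma invariant_measurable: "invariant_under M T \<Longrightarrow> T \<in> measurable M M"
  by (simp add: invariant_under_def)

lemma simple_function_funpow:
  assumes "simple_function M X" shows "simple_function M (\<lambda>x. X ((F ^^ i) x))"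
  by (rule simple_function_comp_measurable[OF assms invariant_measurable[OF invariant_funpow]])

lemma simple_function_orbit:
  assumes "simple_function M X" shows "simple_function M (orbit N X)"
  unfolding orbit_def by (intro simple_function_joint simple_function_funpow assms) simp

text \<open>Split the history at time \<open>m\<close>: the second block is an \<open>n\<close>-step
  history started from \<open>F ^^ m\<close>, and invariance removes that delay.\<close>

lemma ent_orbit_subadditive:
  assumes X: "simple_function M X"
  shows "ent (orbit (m + n) X) \<le> ent (orbit m X) + ent (orbit n X)"
proof -
  note Xn = simple_function_orbit[OF X, of n]
  note Xm = simple_function_orbit[OF X, of m]
  let ?Y = "\<lambda>x. orbit n X ((F ^^ m) x)"
  have Y: "simple_function M ?Y"
    by (rule simple_function_funpow[OF Xn])
  have "ent (orbit (m + n) X) \<le> ent (\<lambda>x. (orbit m X x, ?Y x))"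
  proof (rule ent_mono)
    fix x y assume "(orbit m X x, ?Y x) = (orbit m X y, ?Y y)"
    then have 1: "\<And>i. i < m \<Longrightarrow> X ((F ^^ i) x) = X ((F ^^ i) y)"
      and 2: "\<And>i. i < n \<Longrightarrow> X ((F ^^ (i + m)) x) = X ((F ^^ (i + m)) y)"
      by (simp_all add: orbit_eq_iff funpow_add)
    show "orbit (m + n) X x = orbit (m + n) X y"
      unfolding orbit_eq_iff
    proof (intro allI impI)
      fix i assume i: "i < m + n"
      show "X ((F ^^ i) x) = X ((F ^^ i) y)"
      proof (cases "i < m")
        case False
        with i have "i - m < n" "i - m + m = i" by simp_all
        with 2[of "i - m"] show ?thesis by simp
      qed (rule 1)
    qed
  qed (use Xm Y in simp)
  also have "\<dots> \<le> ent (orbit m X) + ent ?Y" by (rule ent_Pair_le[OF Xm Y])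
  also have "ent ?Y = ent (orbit n X)" by (rule ent_invariant[OF Xn invariant_funpow])
  finally show ?thesis .
qed

abbreviation dyn :: "('a config \<Rightarrow> 'v) \<Rightarrow> real" where
  "dyn X \<equiv> dynamical_entropy M (fibers X) F"

text \<open>Without this convergence \<^const>\<open>lim\<close> would be an unspecified value.\<close>

lemma dyn_LIMSEQ:
  assumes X: "simple_function M X"
  shows "(\<lambda>N. ent (orbit N X) / real N) \<longlonglongrightarrow> dyn X"
proof -
  have "convergent (\<lambda>N. ent (orbit N X) / real N)"
    by (intro fekete_convergent ent_orbit_subadditive ent_nonneg simple_function_orbit X)
  then show ?thesis
    unfolding dynamical_entropy_def pullback_partition_fibers common_refinement_fibers
      orbit_def[symmetric] convergent_LIMSEQ_iff .
qed

lemma dyn_le_ent: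
  assumes X: "simple_function M X" shows "dyn X \<le> ent X"
proof (rule LIMSEQ_le_const2[OF dyn_LIMSEQ[OF X]], intro exI allI impI)
  fix N :: nat assume N: "1 \<le> N"
  have "ent (orbit N X) \<le> (\<Sum>i<N. ent (\<lambda>x. X ((F ^^ i) x)))"
    unfolding orbit_def
    by (intro ent_joint_le simple_function_funpow X) simp
  also have "\<dots> = real N * ent X"
    using ent_invariant[OF X invariant_funpow] by simp
  finally show "ent (orbit N X) / real N \<le> ent X"
    using N by (simp add: divide_le_eq mult.commute)
qed

text \<open>After division by \<open>N\<close> the one-time cost \<open>c\<close> disappears and
  only the cost \<open>d\<close> per unit of time remains.\<close>

lemma dyn_leI:
  assumes X: "simple_function M X" and Y: "simple_function M Y"
    and le: "\<And>N. ent (orbit N X) \<le> ent (orbit N Y) + c + real N * d"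
  shows "dyn X \<le> dyn Y + d"
proof (rule LIMSEQ_le[OF dyn_LIMSEQ[OF X]])
  have "(\<lambda>N. ent (orbit N Y) / real N + c / real N + d) \<longlonglongrightarrow> dyn Y + 0 + d"
    by (intro tendsto_add dyn_LIMSEQ[OF Y] tendsto_const lim_const_over_n)
  then show "(\<lambda>N. ent (orbit N Y) / real N + c / real N + d) \<longlonglongrightarrow> dyn Y + d" by simp
  show "\<exists>N. \<forall>n\<ge>N. ent (orbit n X) / real n \<le> ent (orbit n Y) / real n + c / real n + d"
  proof (intro exI allI impI)
    fix n :: nat assume n: "1 \<le> n"
    have "ent (orbit n X) / real n \<le> (ent (orbit n Y) + c + real n * d) / real n"
      using le[of n] by (intro divide_right_mono) auto
    also have "\<dots> = ent (orbit n Y) / real n + c / real n + d"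
      using n by (simp add: add_divide_distrib)
    finally show "ent (orbit n X) / real n \<le> ent (orbit n Y) / real n + c / real n + d" .
  qed
qed

text \<open>The frame is as wide as the radius, so by induction on time its history together with the
  initial configuration inside the square determines the history of the whole square; the initial
  configuration costs an amount of entropy that does not grow with time.\<close>

lemma ent_orbit_square_le:
  assumes "r \<le> k"
  shows "ent (orbit N (\<lambda>x. restrict x (square k)))
    \<le> ent (orbit N (\<lambda>x. restrict x (frame r k))) + ent (\<lambda>x :: 'a config. restrict x (square k))"
proof -
  let ?S = "\<lambda>x :: 'a config. restrict x (square k)"
  let ?O = "orbit N (\<lambda>x. restrict x (frame r k))"
  have S: "simple_function M ?S" by (rule simple_function_restrict) simp
  have O: "simple_function M ?O" by (intro simple_function_orbit simple_function_restrict) simp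
  have "ent (orbit N ?S) \<le> ent (\<lambda>x. (?O x, ?S x))"
  proof (rule ent_mono)
    fix x y assume "(?O x, ?S x) = (?O y, ?S y)"
    then have init: "?S x = ?S y"
      and fr: "\<And>i. i < N \<Longrightarrow> restrict ((F ^^ i) x) (frame r k) = restrict ((F ^^ i) y) (frame r k)"
      unfolding prod.inject orbit_eq_iff by blast+
    show "orbit N ?S x = orbit N ?S y"
      unfolding orbit_eq_iff using radius_determines_square[OF radius assms init fr] by blast
  qed (use O S in simp)
  also have "\<dots> \<le> ent ?O + ent ?S" by (rule ent_Pair_le[OF O S])
  finally show ?thesis .
qed

lemma dyn_frame_le:
  assumes X: "simple_function M X" and n: "r \<le> n"
  shows "dynamical_entropy M (frame_partition r n (fibers X)) F
    \<le> dynamical_entropy M (frame_partition r (n + m) origin_partition) F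
      + real (card (frame r n)) * cond_ent X (\<lambda>x. restrict x (square m))"
proof -
  let ?S = "\<lambda>k (x :: 'a config). restrict x (square k)"
  let ?J = "joint (frame r n) (\<lambda>v x. X (shift (- v) x))"
  let ?O = "\<lambda>x :: 'a config. restrict x (frame r (n + m))"
  have S: "simple_function M (?S k)" for k by (rule simple_function_restrict) simp
  have O: "simple_function M ?O" by (rule simple_function_restrict) simp
  have J: "simple_function M ?J"
    by (intro simple_function_joint simple_function_comp_measurable[OF X]
        invariant_measurable invariant_shift) simp
  define d where "d = cond_ent X (?S m)"
  \<comment> \<open>The entropy of the initial pattern on \<open>square (n + m)\<close> is
    independent of \<open>N\<close> and plays the part of \<open>c\<close> in
    \<open>dyn_leI\<close>.\<close>
  have main: "ent (orbit N ?J) \<le> ent (orbit N ?O) + ent (?S (n + m)) + real N * (real (card (frame r n)) * d)"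
    for N
  proof -
    \<comment> \<open>Time and frame position are merged into one index, so that a single comparison
      handles every space-time translate of \<open>X\<close>.\<close>
    define I where "I = {..<N} \<times> frame r n"
    define T where "T p x = shift (- snd p) ((F ^^ fst p) x)" for p :: "nat \<times> int \<times> int" and x
    have T: "invariant_under M (T p)" for p
      unfolding T_def[abs_def] by (rule invariant_under_comp[OF invariant_shift invariant_funpow])
    have fin: "finite I" by (simp add: I_def)
    have XT: "simple_function M (\<lambda>x. X (T p x))" and ST: "simple_function M (\<lambda>x. ?S m (T p x))" for p
      using simple_function_comp_measurable[OF X invariant_measurable[OF T]]
        simple_function_comp_measurable[OF S invariant_measurable[OF T]] .
    have "ent (orbit N ?J) \<le> ent (joint I (\<lambda>p x. X (T p x)))"
    proof (rule ent_mono)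
      fix x y assume "joint I (\<lambda>p x. X (T p x)) x = joint I (\<lambda>p x. X (T p x)) y"
      then have "X (T (i, v) x) = X (T (i, v) y)" if "i < N" "v \<in> frame r n" for i v
        using that unfolding joint_eq_iff I_def by blast
      then show "orbit N ?J x = orbit N ?J y"
        by (simp add: orbit_eq_iff joint_eq_iff T_def)
    qed (intro simple_function_joint fin XT)
    also have "\<dots> \<le> ent (joint I (\<lambda>p x. ?S m (T p x))) + real (card I) * d"
    proof (rule ent_joint_comp_le[OF fin XT ST])
      fix p
      \<comment> \<open>Invariance under both \<open>F\<close> and the shifts makes the error the
        same at every time and position.\<close>
      show "cond_ent (\<lambda>x. X (T p x)) (\<lambda>x. ?S m (T p x)) \<le> d"
        using cond_ent_invariant[OF X S T] by (simp add: d_def)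
    qed
    also have "ent (joint I (\<lambda>p x. ?S m (T p x))) \<le> ent (orbit N (?S (n + m)))"
    proof (rule ent_mono)
      fix x y assume eq: "orbit N (?S (n + m)) x = orbit N (?S (n + m)) y"
      have "?S m (T (i, v) x) = ?S m (T (i, v) y)" if "i < N" "v \<in> frame r n" for i v
      proof -
        \<comment> \<open>A translate of \<open>square m\<close> by a frame vector has its sites
          within distance \<open>n + m\<close> of the origin.\<close>
        have "u - v \<in> square (n + m)" if "u \<in> square m" for u
          using that \<open>v \<in> frame r n\<close> by (cases u; cases v) (auto simp: frame_def square_def)
        moreover have "(F ^^ i) x u = (F ^^ i) y u" if "u \<in> square (n + m)" for u
          using eq \<open>i < N\<close> that unfolding orbit_eq_iff restrict_eq_iff by blast
        ultimately show ?thesis by (simp add: restrict_eq_iff T_def shift_def)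
      qed
      then show "joint I (\<lambda>p x. ?S m (T p x)) x = joint I (\<lambda>p x. ?S m (T p x)) y"
        unfolding joint_eq_iff I_def by auto
    qed (intro simple_function_orbit S)
    also have "\<dots> \<le> ent (orbit N ?O) + ent (?S (n + m))"
      by (rule ent_orbit_square_le) (use n in simp)
    finally show ?thesis by (simp add: I_def card_cartesian_product)
  qed
  have "dyn ?J \<le> dyn ?O + real (card (frame r n)) * d"
    by (rule dyn_leI[OF J O main])
  then show ?thesis by (simp only: frame_partition_fibers frame_partition_origin d_def)
qed

text \<open>The linear bound controls the error made when \<open>n\<close> is exchanged for
  \<open>n + m\<close> in the denominator.\<close>

lemma dyn_frame_origin_le:
  assumes "r \<le> n" "1 \<le> n"
  shows "dynamical_entropy M (frame_partition r n origin_partition) F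
    \<le> 12 * real r * real n * ent (\<lambda>x :: 'a config. x (0, 0))"
proof -
  let ?Z = "\<lambda>x :: 'a config. x (0, 0)"
  let ?J = "joint (frame r n) (\<lambda>v x. ?Z (shift (- v) x))"
  have Zv: "simple_function M (\<lambda>x. ?Z (shift (- v) x))" for v
    by (rule simple_function_comp_measurable[OF simple_function_coordinate
          invariant_measurable[OF invariant_shift]])
  have "dyn ?J \<le> ent ?J" by (intro dyn_le_ent simple_function_joint Zv) simp
  also have "\<dots> \<le> (\<Sum>v\<in>frame r n. ent (\<lambda>x. ?Z (shift (- v) x)))"
    by (intro ent_joint_le Zv) simp
  also have "\<dots> = real (card (frame r n)) * ent ?Z"
    using ent_invariant[OF simple_function_coordinate invariant_shift] by simp
  also have "\<dots> \<le> 12 * real r * real n * ent ?Z"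
    by (intro mult_right_mono card_frame_le assms ent_nonneg simple_function_coordinate)
  finally show ?thesis by (simp only: origin_partition_fibers frame_partition_fibers)
qed

lemma entropy_rate_le_add:
  assumes X: "simple_function M X"
  shows "entropy_rate M F r (fibers X) \<le> entropy_rate M F r origin_partition
    + ereal (12 * real r * cond_ent X (\<lambda>x. restrict x (square m)))"
proof -
  define s where "s n = dynamical_entropy M (frame_partition r n origin_partition) F" for n
  define p where "p n = dynamical_entropy M (frame_partition r n (fibers X)) F" for n
  define D where "D = cond_ent X (\<lambda>x. restrict x (square m))"
  define K where "K = 12 * real r * ent (\<lambda>x :: 'a config. x (0, 0))"
  have D: "0 \<le> D"
  proof -
    have "ent (\<lambda>x. restrict x (square m)) \<le> ent (\<lambda>x. (X x, restrict x (square m)))"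
      using X simple_function_restrict[OF finite_square] by (intro ent_mono) auto
    then show ?thesis by (simp add: D_def cond_ent_def)
  qed
  have bound: "p n / real n \<le> s (n + m) / real (n + m) + (K * (real m / real n) + 12 * real r * D)"
    if n: "max r 1 \<le> n" for n
  proof -
    have n0: "0 < real n" "0 < real (n + m)" using n by auto
    have "p n \<le> s (n + m) + real (card (frame r n)) * D"
      unfolding p_def s_def D_def using n by (intro dyn_frame_le X) simp
    also have "\<dots> \<le> s (n + m) + 12 * real r * real n * D"
      using n D by (intro add_left_mono mult_right_mono card_frame_le) auto
    finally have "p n / real n \<le> (s (n + m) + 12 * real r * real n * D) / real n"
      using n0 by (intro divide_right_mono) auto
    also have "\<dots> = s (n + m) / real n + 12 * real r * D" using n0 by (simp add: add_divide_distrib)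
    \<comment> \<open>The factor \<open>(n + m) / n\<close> equals \<open>1 + m / n\<close>; its
      excess over 1 multiplies a bounded quantity and so vanishes in the limit.\<close>
    also have "s (n + m) / real n = s (n + m) / real (n + m) + s (n + m) / real (n + m) * (real m / real n)"
    proof -
      have "s (n + m) / real n = s (n + m) / real (n + m) * (real (n + m) / real n)" using n0 by simp
      also have "real (n + m) / real n = 1 + real m / real n" using n0 by (simp add: add_divide_distrib)
      finally show ?thesis by (simp add: distrib_left)
    qed
    also have "s (n + m) / real (n + m) * (real m / real n) \<le> K * (real m / real n)"
    proof (rule mult_right_mono)
      have "s (n + m) \<le> 12 * real r * real (n + m) * ent (\<lambda>x :: 'a config. x (0, 0))"
        unfolding s_def using n by (intro dyn_frame_origin_le) auto
      then have "s (n + m) \<le> K * real (n + m)" by (simp only: K_def mult_ac)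
      then show "s (n + m) / real (n + m) \<le> K" using n0 by (simp add: pos_divide_le_eq)
    qed simp
    finally show ?thesis by simp
  qed
  \<comment> \<open>The error terms form a convergent sequence, so they can be taken out of the
    limit superior.\<close>
  define v where "v n = ereal (K * (real m / real n) + 12 * real r * D)" for n
  have "(\<lambda>n. K * (real m / real n) + 12 * real r * D) \<longlonglongrightarrow> K * 0 + 12 * real r * D"
    by (intro tendsto_add tendsto_mult tendsto_const lim_const_over_n)
  then have v: "v \<longlonglongrightarrow> ereal (12 * real r * D)" unfolding v_def by simp
  have "entropy_rate M F r (fibers X) = limsup (\<lambda>n. ereal (p n / real n))"
    by (simp add: entropy_rate_def p_def)
  also have "\<dots> \<le> limsup (\<lambda>n. v n + ereal (s (n + m) / real (n + m)))"
  proof (rule Limsup_mono)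
    show "eventually (\<lambda>n. ereal (p n / real n) \<le> v n + ereal (s (n + m) / real (n + m))) sequentially"
      unfolding eventually_sequentially
      by (rule exI[of _ "max r 1"]) (use bound in \<open>simp add: v_def add.commute\<close>)
  qed
  also have "\<dots> = ereal (12 * real r * D) + limsup (\<lambda>n. ereal (s (n + m) / real (n + m)))"
    by (rule ereal_limsup_lim_add[OF v]) simp
  also have "limsup (\<lambda>n. ereal (s (n + m) / real (n + m))) = limsup (\<lambda>n. ereal (s n / real n))"
    by (rule limsup_shift_k)
  also have "\<dots> = entropy_rate M F r origin_partition"
    by (simp add: entropy_rate_def s_def)
  finally show ?thesis by (simp add: D_def add.commute)
qed

lemma entropy_rate_le_origin:
  assumes P: "finite_measurable_partition M P"
  shows "entropy_rate M F r P \<le> entropy_rate M F r origin_partition"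
proof -
  have part: "partition_on UNIV P" and meas: "finite P" "P \<subseteq> sets M"
    using P by (auto simp: finite_measurable_partition_def)
  obtain X where PX: "P = fibers X" and X: "range X = P" "\<And>x B. B \<in> P \<Longrightarrow> X x = B \<longleftrightarrow> x \<in> B"
    using partition_on_UNIV_fibers[OF part] by blast
  have sf: "simple_function M X"
    unfolding simple_function_def
  proof safe
    show "finite (X ` space M)" using meas(1) X(1) by simp
    fix x
    have Xx: "X x \<in> P" using X(1) by (metis rangeI)
    then have "X -` {X x} = X x" by (simp add: vimage_def X(2))
    then show "X -` {X x} \<inter> space M \<in> sets M" using Xx meas(2) by auto
  qed
  have "entropy_rate M F r (fibers X) \<le> entropy_rate M F r origin_partition + ereal e" if e: "0 < e" for e
  proof -
    \<comment> \<open>The summand 1 keeps the denominator positive for radius 0.\<close>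
    have "0 < e / (12 * real r + 1)" using e by simp
    from cond_ent_cylinders_small[OF P X this]
    obtain m where m: "cond_ent X (\<lambda>x. restrict x (square m)) < e / (12 * real r + 1)" by blast
    have "12 * real r * cond_ent X (\<lambda>x. restrict x (square m)) \<le> 12 * real r * (e / (12 * real r + 1))"
      using m by (intro mult_left_mono) auto
    also have "\<dots> \<le> e" using e by (simp add: field_simps)
    finally have "ereal (12 * real r * cond_ent X (\<lambda>x. restrict x (square m))) \<le> ereal e" by simp
    then show ?thesis
      by (rule order_trans[OF entropy_rate_le_add[OF sf, of m] add_left_mono])
  qed
  then show ?thesis unfolding PX by (rule ereal_le_epsilon2)
qed

text \<open>It makes the origin partition a competitor in the supremum, which gives the reverse
  inequality for the total rate.\<close>

lemma finite_measurable_partition_origin: "finite_measurable_partition M origin_partition"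
  unfolding finite_measurable_partition_def
proof (intro conjI)
  show "finite (origin_partition :: 'a config set set)" by (simp add: origin_partition_def)
  show "partition_on (space M) origin_partition"
  proof (rule partition_onI)
    show "\<Union> origin_partition = space M" by (auto simp: origin_partition_def)
  next
    fix p q :: "'a config set" assume pq: "p \<in> origin_partition" "q \<in> origin_partition" "p \<noteq> q"
    then obtain a b where ab: "p = {x. x (0, 0) = a}" "q = {x. x (0, 0) = b}"
      unfolding origin_partition_def by blast
    with pq(3) have "a \<noteq> b" by metis
    then show "disjnt p q" unfolding ab disjnt_def by blast
  next
    show "{} \<notin> (origin_partition :: 'a config set set)"
    proof
      assume "{} \<in> (origin_partition :: 'a config set set)"
      then obtain a :: 'a where a: "{} = {x :: 'a config. x (0, 0) = a}"
        unfolding origin_partition_def by (rule rangeE)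
      have "(\<lambda>_. a) \<in> {x :: 'a config. x (0, 0) = a}" by simp
      then show False unfolding a[symmetric] by simp
    qed
  qed
  show "origin_partition \<subseteq> sets M"
  proof
    fix B :: "'a config set" assume "B \<in> origin_partition"
    then obtain a where "B = (\<lambda>x. x (0, 0)) -` {a}"
      unfolding origin_partition_def vimage_def singleton_iff by blast
    then show "B \<in> sets M" using vimage_in_sets_simple[OF simple_function_coordinate] by simp
  qed
qed

end

theorem proposition2:
  fixes F :: "('a::finite) config \<Rightarrow> 'a config" and \<mu> :: "'a config measure" and r :: nat
  assumes "cellular_automaton F"
    and "has_radius F r"
    and "bi_invariant_prob \<mu> F"
  shows "(\<forall>P. finite_measurable_partition \<mu> P \<longrightarrow>
            entropy_rate \<mu> F r P \<le> entropy_rate \<mu> F r origin_partition) \<and>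
         total_entropy_rate \<mu> F r = entropy_rate \<mu> F r origin_partition"
proof -
  interpret prob_space \<mu> using assms(3) by (simp add: bi_invariant_prob_def)
  interpret bi_invariant_ca \<mu> F r
    using assms(2,3) unfolding bi_invariant_prob_def by unfold_locales blast+
  have "total_entropy_rate \<mu> F r = entropy_rate \<mu> F r origin_partition"
    unfolding total_entropy_rate_def
  proof (rule antisym)
    show "(SUP P\<in>{P. finite_measurable_partition \<mu> P}. entropy_rate \<mu> F r P) \<le> entropy_rate \<mu> F r origin_partition"
      using entropy_rate_le_origin by (intro SUP_least) simp
    show "entropy_rate \<mu> F r origin_partition \<le> (SUP P\<in>{P. finite_measurable_partition \<mu> P}. entropy_rate \<mu> F r P)"
      using finite_measurable_partition_origin by (intro SUP_upper) simp
  qed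
  then show ?thesis using entropy_rate_le_origin by blast
qed

end
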